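(* The graph $\mathcal{G}$ of minimal sets has finite connected components of arbitrarily large height, and it contains infinitely many isolated vertices.
   Context: $X$ is the graph with vertex set $\mathbb{Z}^2$ in which $(x,y)$ and $(x',y')$ are adjacent iff $|x-x'|+|y-y'|=1$. For $A\subset\mathbb{Z}^2$, $\partial A=\{u\in\mathbb{Z}^2\setminus A:\ u \text{ adjacent to some } v\in A\}$. A finite nonempty set $A$ is minimal if $|\partial A|\le|\partial C|$ for all $C\subset\mathbb{Z}^2$ with $|C|=|A|$. Two sets are congruent if some graph automorphism of $X$ maps one onto the other. The graph $\mathcal{G}$ has as vertices the congruence classes of minimal sets; two vertices are joined by an edge if they have representatives whose symmetric difference has exactly one element. The height of a component of $\mathcal{G}$ is the maximal length of a nested sequence of minimal sets whose congruence classes lie in that component. *)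

theory Defs
  imports Main "HOL-Library.Extended_Nat"
begin

type_synonym point = "int \<times> int"

definition adj :: "point \<Rightarrow> point \<Rightarrow> bool" where
  "adj u v \<longleftrightarrow> \<bar>fst u - fst v\<bar> + \<bar>snd u - snd v\<bar> = 1"

definition boundary :: "point set \<Rightarrow> point set" where
  "boundary A = {u. u \<notin> A \<and> (\<exists>v\<in>A. adj u v)}"

definition minimal :: "point set \<Rightarrow> bool" where
  "minimal A \<longleftrightarrow> finite A \<and> A \<noteq> {} \<and>
     (\<forall>C. finite C \<and> card C = card A \<longrightarrow> card (boundary A) \<le> card (boundary C))"

definition automorphism :: "(point \<Rightarrow> point) \<Rightarrow> bool" where
  "automorphism f \<longleftrightarrow> bij f \<and> (\<forall>u v. adj (f u) (f v) \<longleftrightarrow> adj u v)"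

definition congruent :: "point set \<Rightarrow> point set \<Rightarrow> bool" where
  "congruent A B \<longleftrightarrow> (\<exists>f. automorphism f \<and> f ` A = B)"

definition cong_class :: "point set \<Rightarrow> point set set" where
  "cong_class A = {B. congruent A B}"

definition G_verts :: "point set set set" where
  "G_verts = cong_class ` {A. minimal A}"

definition G_edges :: "(point set set \<times> point set set) set" where
  "G_edges = {(P, Q). P \<in> G_verts \<and> Q \<in> G_verts \<and>
     (\<exists>A\<in>P. \<exists>B\<in>Q. card (sym_diff A B) = 1)}"

definition G_components :: "point set set set set" where
  "G_components = {G_edges\<^sup>* `` {P} |P. P \<in> G_verts}"

definition G_isolated :: "point set set \<Rightarrow> bool" where
  "G_isolated P \<longleftrightarrow> P \<in> G_verts \<and> \<not> (\<exists>Q. (P, Q) \<in> G_edges)"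

text \<open>Nested sequences are strictly increasing and their length is the number of their terms.
  The height is an extended natural number, since an infinite component may contain
  arbitrarily long nested sequences.\<close>

definition nested_seq_in :: "point set set set \<Rightarrow> point set list \<Rightarrow> bool" where
  "nested_seq_in K As \<longleftrightarrow> sorted_wrt (\<subset>) As \<and> (\<forall>A\<in>set As. minimal A \<and> cong_class A \<in> K)"

definition height :: "point set set set \<Rightarrow> enat" where
  "height K = Sup {enat (length As) |As. nested_seq_in K As}"

end

theory Submission imports Defs begin

text \<open>
  In the coordinates \<open>u = x + y\<close> and \<open>v = x - y\<close>, split a finite set \<open>A\<close> into its two parity classes.
  The neighbours of either class lie in the other class or in the boundary, and a sumset estimate
  shows that \<open>A\<close> has at least \<open>U + V + 2\<close> boundary points, where \<open>U\<close> and \<open>V\<close> count the diagonals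
  met by \<open>A\<close>. Moreover more than \<open>2 k\<^sup>2 - k\<close> points and at most \<open>4 k + 2\<close> boundary points force
  \<open>U + V = 4 k\<close>, so the two projections cannot change when a point is added or removed within
  this regime. Take a diamond with \<open>2 (k + e)\<close> and \<open>2 (k - e)\<close> diagonals, where \<open>k = 2 e\<^sup>2 + j\<close>. It has
  \<open>4 k + 2\<close> boundary points and \<open>2 k\<^sup>2 - k + j\<close> points. Its component consists of classes of its subsets:
  up to size \<open>2 k\<^sup>2\<close> a minimal set has at most \<open>4 k + 2\<close> boundary points, by comparison with the
  balanced diamond, so its projections stay fixed and no outside point can be added; and descending
  to \<open>2 k\<^sup>2 - k\<close> points would require emptying a whole diagonal, which has more than \<open>j\<close> points. Removing
  topmost points never increases the boundary, so the component has height at least \<open>j\<close>; for \<open>j = 1\<close>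
  it is a single vertex.
\<close>

section \<open>Diagonal coordinates, neighbourhoods and the sumset estimate\<close>

definition usum :: "point \<Rightarrow> int" where "usum z = fst z + snd z"
definition vdif :: "point \<Rightarrow> int" where "vdif z = fst z - snd z"

definition extent :: "point set \<Rightarrow> nat" where
  "extent A = card (usum ` A) + card (vdif ` A)"

definition nbhd :: "point set \<Rightarrow> point set" where
  "nbhd S = {z. \<exists>w\<in>S. adj z w}"

lemma adj_cases: "adj (x, y) (a, b) \<longleftrightarrow>
    (a = x + 1 \<and> b = y) \<or> (a = x - 1 \<and> b = y) \<or> (a = x \<and> b = y + 1) \<or> (a = x \<and> b = y - 1)"
  unfolding adj_def by (simp add: abs_if) arith

lemma mem_nbhd: "(x, y) \<in> nbhd S \<longleftrightarrow>
    (x + 1, y) \<in> S \<or> (x - 1, y) \<in> S \<or> (x, y + 1) \<in> S \<or> (x, y - 1) \<in> S"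
  by (simp add: nbhd_def Bex_def adj_cases) blast

lemma mem_translate: "(x, y) \<in> (\<lambda>(x, y). (x + a, y + b)) ` S \<longleftrightarrow> (x - a, y - b) \<in> S"
  for x y a b :: int
proof
  assume "(x - a, y - b) \<in> S"
  then show "(x, y) \<in> (\<lambda>(x, y). (x + a, y + b)) ` S" by (rule rev_image_eqI) simp
qed auto

lemma nbhd_eq:
  "nbhd S = (\<lambda>(x, y). (x + 1, y + 0)) ` S \<union> (\<lambda>(x, y). (x + - 1, y + 0)) ` S
    \<union> (\<lambda>(x, y). (x + 0, y + 1)) ` S \<union> (\<lambda>(x, y). (x + 0, y + - 1)) ` S"
  by (simp only: set_eq_iff split_paired_All mem_nbhd mem_translate Un_iff) auto

lemma finite_nbhd: "finite S \<Longrightarrow> finite (nbhd S)"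
  by (simp only: nbhd_eq finite_Un finite_imageI)

lemma boundary_eq: "boundary A = nbhd A - A"
  unfolding boundary_def nbhd_def by auto

lemma finite_boundary: "finite A \<Longrightarrow> finite (boundary A)"
  by (simp add: boundary_eq finite_nbhd)

text \<open>In each fibre of \<open>f\<close>, a point of \<open>S\<close> with maximal
  \<open>g\<close> is moved by \<open>h\<close> out of \<open>S\<close> but stays in the fibre, so
  different fibres yield different new points.\<close>

lemma card_union_translate:
  fixes g :: "'a \<Rightarrow> int"
  assumes fin: "finite S" and f: "\<And>z. f (h z) = f z" and g: "\<And>z. g z < g (h z)"
  shows "card S + card (f ` S) \<le> card (S \<union> h ` S)"
proof -
  have "\<exists>z\<in>S. f z = c \<and> h z \<notin> S" if "c \<in> f ` S" for c
  proof -
    let ?F = "{z \<in> S. f z = c}"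
    have "finite ?F" "?F \<noteq> {}" using fin that by auto
    then have fin': "finite (g ` ?F)" "g ` ?F \<noteq> {}" by auto
    from Max_in[OF this] obtain z where z: "z \<in> ?F" "Max (g ` ?F) = g z" by (rule imageE)
    have "h z \<notin> S"
    proof
      assume "h z \<in> S"
      then have "g (h z) \<in> g ` ?F" using z(1) f[of z] by blast
      then have "g (h z) \<le> g z" using Max_ge[OF fin'(1)] z(2) by metis
      then show False using g[of z] by simp
    qed
    with z(1) show ?thesis by auto
  qed
  then obtain t where t: "\<And>c. c \<in> f ` S \<Longrightarrow> t c \<in> S \<and> f (t c) = c \<and> h (t c) \<notin> S" by metis
  let ?T = "(\<lambda>c. h (t c)) ` f ` S"
  have "inj_on (\<lambda>c. h (t c)) (f ` S)" by (rule inj_onI) (metis f t)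
  then have "card ?T = card (f ` S)" by (rule card_image)
  moreover have "card (S \<union> ?T) = card S + card ?T"
    using fin t by (intro card_Un_disjoint) auto
  moreover have "card (S \<union> ?T) \<le> card (S \<union> h ` S)"
    using fin t by (intro card_mono) auto
  ultimately show ?thesis by simp
qed

text \<open>The four neighbours of a point are obtained from it by a diagonal step in one direction
  followed by one in the other, up to a translation.\<close>

lemma card_nbhd_ge:
  assumes "finite S" "S \<noteq> {}"
  shows "card S + extent S + 1 \<le> card (nbhd S)"
proof -
  let ?h = "\<lambda>(x, y). (x + 1, y + 1) :: point" and ?h' = "\<lambda>(x, y). (x + 1, y + - 1) :: point"
  let ?T = "S \<union> ?h ` S"
  have 1: "card S + card (vdif ` S) \<le> card ?T"
    by (rule card_union_translate[where g = fst]) (auto simp: vdif_def assms)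
  have 2: "card ?T + card (usum ` ?T) \<le> card (?T \<union> ?h' ` ?T)"
    by (rule card_union_translate[where g = fst]) (auto simp: usum_def assms)
  have "card (usum ` S) + 1 \<le> card (usum ` ?T)"
  proof -
    have "usum ` ?T = usum ` S \<union> (\<lambda>c. c + 2) ` usum ` S"
      by (simp add: image_Un image_image usum_def case_prod_unfold algebra_simps)
    moreover have "card (usum ` S) + card ((\<lambda>_. 0 :: int) ` usum ` S) \<le> card (usum ` S \<union> (\<lambda>c. c + 2) ` usum ` S)"
      by (rule card_union_translate[where g = id]) (auto simp: assms)
    \<comment> \<open>For constant \<open>f\<close> there is a single fibre: the shift by 2 creates
      at least one new value, which is the extra 1.\<close>
    moreover have "card ((\<lambda>_. 0 :: int) ` usum ` S) = 1"
      using assms by (simp add: image_constant_conv)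
    ultimately show ?thesis by simp
  qed
  moreover have "card (?T \<union> ?h' ` ?T) = card (nbhd S)"
  proof -
    let ?t = "\<lambda>(x, y). (x + - 1, y + 0) :: point"
    have "(x, y) \<in> nbhd S \<longleftrightarrow> (x, y) \<in> ?t ` (?T \<union> ?h' ` ?T)" for x y
      unfolding mem_nbhd mem_translate Un_iff by (auto simp: algebra_simps)
    then have "nbhd S = ?t ` (?T \<union> ?h' ` ?T)" by (intro set_eqI) (metis surj_pair)
    moreover have "inj_on ?t (?T \<union> ?h' ` ?T)" by (auto simp: inj_on_def)
    ultimately show ?thesis by (simp only: card_image)
  qed
  ultimately show ?thesis using 1 2 unfolding extent_def by linarith
qed

lemma card_le_usum_vdif:
  assumes "finite S" shows "card S \<le> card (usum ` S) * card (vdif ` S)"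
proof -
  have "inj (\<lambda>z. (usum z, vdif z))" by (auto simp: inj_def usum_def vdif_def)
  then have "card S = card ((\<lambda>z. (usum z, vdif z)) ` S)"
    by (metis card_image inj_on_subset subset_UNIV)
  also have "\<dots> \<le> card (usum ` S \<times> vdif ` S)" using assms by (intro card_mono) auto
  finally show ?thesis by (simp add: card_cartesian_product)
qed

text \<open>AM-GM for the two projection counts, whose product bounds the cardinality.\<close>

lemma four_card_le:
  assumes "finite S" shows "4 * card S \<le> extent S * extent S"
proof -
  have "4 * (a * b) \<le> (a + b) * (a + b)" for a b :: nat
  proof -
    have "0 \<le> (int a - int b) * (int a - int b)" by simp
    then have "4 * (int a * int b) \<le> (int a + int b) * (int a + int b)" by (simp add: algebra_simps)
    then show ?thesis by (metis (no_types, lifting) of_nat_add of_nat_le_iff of_nat_mult of_nat_numeral)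
  qed
  then show ?thesis using card_le_usum_vdif[OF assms] unfolding extent_def
    by (meson le_trans mult_le_mono2)
qed

section \<open>Parity classes and lower bounds for the boundary\<close>

definition parity_part :: "bool \<Rightarrow> point set \<Rightarrow> point set" where
  "parity_part r A = {z \<in> A. even (usum z) = r}"

lemma parity_part_Un: "A = parity_part r A \<union> parity_part (\<not> r) A"
  and parity_part_disjoint: "parity_part r A \<inter> parity_part (\<not> r) A = {}"
  unfolding parity_part_def by auto

lemma finite_parity_part: "finite A \<Longrightarrow> finite (parity_part r A)"
  unfolding parity_part_def by simp

lemma card_parity_part:
  "finite A \<Longrightarrow> card A = card (parity_part r A) + card (parity_part (\<not> r) A)"
  by (metis card_Un_disjoint finite_parity_part parity_part_Un parity_part_disjoint)

text \<open>\<open>usum\<close> and \<open>vdif\<close> have equal parity at every point, so points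
  of opposite classes share no diagonal.\<close>

lemma extent_parity_part:
  assumes "finite A"
  shows "extent A = extent (parity_part r A) + extent (parity_part (\<not> r) A)"
proof -
  have "card (f ` A) = card (f ` parity_part r A) + card (f ` parity_part (\<not> r) A)"
    if "\<And>z. even (f z) = even (usum z)" for f :: "point \<Rightarrow> int"
  proof -
    have "f ` A = f ` parity_part r A \<union> f ` parity_part (\<not> r) A"
      using parity_part_Un[of A r] by (metis image_Un)
    moreover have "f ` parity_part r A \<inter> f ` parity_part (\<not> r) A = {}"
    proof (rule ccontr)
      assume "\<not> ?thesis"
      then obtain z w where "f z = f w" "even (usum z) = r" "even (usum w) = (\<not> r)"
        unfolding parity_part_def by auto
      then show False using that by metis
    qed
    ultimately show ?thesis by (simp add: card_Un_disjoint assms finite_parity_part)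
  qed
  from this[of usum] this[of vdif] show ?thesis
    unfolding extent_def by (auto simp: usum_def vdif_def)
qed

lemma card_parity_part_boundary:
  assumes "finite A" "parity_part r A \<noteq> {}"
  shows "card (parity_part r A) + extent (parity_part r A) + 1
    \<le> card (parity_part (\<not> r) A) + card (parity_part (\<not> r) (boundary A))"
proof -
  have "nbhd (parity_part r A) \<subseteq> parity_part (\<not> r) A \<union> parity_part (\<not> r) (boundary A)"
    by (rule subrelI) (auto simp: boundary_eq mem_nbhd parity_part_def usum_def)
  then have "card (nbhd (parity_part r A))
      \<le> card (parity_part (\<not> r) A \<union> parity_part (\<not> r) (boundary A))"
    using assms by (intro card_mono) (auto simp: finite_parity_part finite_boundary)
  also have "\<dots> \<le> card (parity_part (\<not> r) A) + card (parity_part (\<not> r) (boundary A))"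
    by (rule card_Un_le)
  finally show ?thesis
    using card_nbhd_ge[of "parity_part r A"] assms finite_parity_part by fastforce
qed

text \<open>Adding the estimates for the two classes cancels their cardinalities and leaves two
  units.\<close>

lemma extent_le_boundary:
  assumes "finite A" "A \<noteq> {}"
  shows "extent A + 2 \<le> card (boundary A)"
proof -
  obtain r where r: "parity_part r A \<noteq> {}" using assms parity_part_Un[of A True] by blast
  note b = card_parity_part[OF finite_boundary[OF assms(1)], of r]
  note x = extent_parity_part[OF assms(1), of r]
  note 1 = card_parity_part_boundary[OF assms(1) r]
  show ?thesis
  proof (cases "parity_part (\<not> r) A = {}")
    case True
    \<comment> \<open>With only one class present, its cardinality is at least 1 and supplies the
      second unit.\<close>
    have "card (parity_part r A) > 0" using r assms finite_parity_part card_gt_0_iff by blast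
    moreover have "extent (parity_part (\<not> r) A) = 0" by (simp add: True extent_def)
    ultimately show ?thesis using b x 1 True by simp
  next
    case False
    from card_parity_part_boundary[OF assms(1) this] show ?thesis using b x 1 by simp
  qed
qed

text \<open>If one parity class has much smaller extent than the other, then it is small itself and
  cannot absorb the neighbours of the other class, which therefore lie in the boundary.\<close>

lemma card_le_of_small_extent:
  assumes fin: "finite A" and k: "k \<ge> 3" and b: "card (boundary A) \<le> 4 * k + 2"
    and x: "extent A \<le> 4 * k - 1"
  shows "card A + k \<le> 2 * k * k"
proof (cases "A = {}")
  case True
  then show ?thesis using k by simp
next
  case False
  obtain r where r: "extent (parity_part (\<not> r) A) \<le> extent (parity_part r A)"
    using that[of True] that[of False] by fastforce
  define a0 a1 s0 s1 where "a0 = int (card (parity_part r A))" "a1 = int (card (parity_part (\<not> r) A))"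
    "s0 = int (extent (parity_part r A))" "s1 = int (extent (parity_part (\<not> r) A))"
  note d = a0_a1_s0_s1_def
  define K where "K = int k"
  have A: "int (card A) = a0 + a1" using card_parity_part[OF fin, of r] d by simp
  have q0: "4 * a0 \<le> s0 * s0" and q1: "4 * a1 \<le> s1 * s1"
    using four_card_le[OF finite_parity_part[OF fin]] unfolding d
    by (metis of_nat_le_iff of_nat_mult of_nat_numeral)+
  have nn: "0 \<le> s1" "s1 \<le> s0" "0 \<le> a0" "0 \<le> a1" using r d by auto
  have K: "3 \<le> K" using k K_def by simp
  have S: "s0 + s1 \<le> 4 * K - 1"
    using x extent_parity_part[OF fin, of r] K_def k d by linarith
  have "parity_part r A \<noteq> {}"
  proof
    assume "parity_part r A = {}"
    then have "s0 = 0" by (simp add: d extent_def)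
    then have "a0 = 0" "a1 = 0" using q0 q1 nn by auto
    then show False using A False fin by simp
  qed
  then have D: "a0 + s0 + 1 \<le> a1 + 4 * K + 2"
    using card_parity_part_boundary[OF fin, of r] b card_parity_part[OF finite_boundary[OF fin], of r]
    unfolding d K_def by simp
  \<comment> \<open>Integrality absorbs the 1 in (2K - 1)^2 = 4(K^2 - K) + 1.\<close>
  have quarter: "x \<le> y" if "4 * x \<le> 4 * y + 1" for x y :: int using that by presburger
  have "a0 + a1 + K \<le> 2 * (K * K)"
  proof (cases "s1 \<ge> 2 * K - 1")
    case True
    \<comment> \<open>This is an extremal case: the bounds K^2 and K^2 - K add up to exactly 2K^2 -
      K.\<close>
    then have s: "s1 = 2 * K - 1" "s0 \<le> 2 * K" using S nn by auto
    have "s0 * s0 \<le> (2 * K) * (2 * K)" using s nn by (intro mult_mono) auto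
    then have a0: "a0 \<le> K * K" using q0 by simp
    have "4 * a1 \<le> 4 * (K * K - K) + 1" using q1 s by (simp add: algebra_simps)
    then have "a1 \<le> K * K - K" by (rule quarter)
    with a0 show ?thesis by simp
  next
    case False
    show ?thesis
    \<comment> \<open>From K + 3 on, \<open>D\<close> gives a0 \<le> a1 + 3K - 2, which with a1
      \<le> (K - 1)^2 just meets the bound. Below it both extents are at most K + 2 and
      \<open>four_card_le\<close> suffices.\<close>
    proof (cases "s0 \<ge> K + 3")
      case True
      have "s1 * s1 \<le> (2 * K - 2) * (2 * K - 2)" using False nn by (intro mult_mono) auto
      then have "4 * a1 \<le> 4 * (K * K - 2 * K + 1) + 1" using q1 by (simp add: algebra_simps)
      then have "a1 \<le> K * K - 2 * K + 1" by (rule quarter)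
      then show ?thesis using D True by simp
    next
      case False
      have "s0 * s0 \<le> (K + 2) * (K + 2)" "s1 * s1 \<le> (K + 2) * (K + 2)"
        using False nn by (intro mult_mono; simp)+
      then have "2 * (a0 + a1) \<le> K * K + 4 * K + 4" using q0 q1 by (simp add: algebra_simps)
      moreover have "3 * K \<le> K * K" using K by simp
      moreover have "x + K \<le> 2 * w" if "2 * x \<le> w + 4 * K + 4" "3 * K \<le> w" for x w
        using that K by linarith
      ultimately show ?thesis by blast
    qed
  qed
  then have "int (card A + k) \<le> int (2 * k * k)" using A K_def by (simp add: mult.assoc)
  then show ?thesis by (simp only: of_nat_le_iff)
qed

section \<open>Shrinking sets without enlarging the boundary\<close>

text \<open>The point above a topmost point has no other neighbour in the set.\<close>

lemma boundary_remove_top: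
  assumes "finite A" "A \<noteq> {}"
  obtains x where "x \<in> A" "card (boundary (A - {x})) \<le> card (boundary A)"
proof -
  have "finite (snd ` A)" "snd ` A \<noteq> {}" using assms by auto
  note m = Max_in[OF this] Max_ge[OF this(1)]
  from m(1) obtain a b where "(a, b) \<in> A" "Max (snd ` A) = b" by auto
  with m(2) have z: "(a, b) \<in> A" "\<And>w. w \<in> A \<Longrightarrow> snd w \<le> b" by blast+
  let ?t = "(a, b + 1)"
  have t: "?t \<in> boundary A" using z(1) z(2)[of ?t] by (auto simp: boundary_eq mem_nbhd)
  have "?t \<notin> boundary (A - {(a, b)})"
    using z(2)[of "(a + 1, b + 1)"] z(2)[of "(a - 1, b + 1)"] z(2)[of "(a, b + 1 + 1)"]
    by (auto simp: boundary_eq mem_nbhd)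
  \<comment> \<open>At most the removed point enters the boundary, while \<open>?t\<close> leaves
    it.\<close>
  then have "boundary (A - {(a, b)}) \<subseteq> insert (a, b) (boundary A - {?t})"
    unfolding boundary_def by blast
  then have "card (boundary (A - {(a, b)})) \<le> card (insert (a, b) (boundary A - {?t}))"
    by (intro card_mono) (simp add: finite_boundary assms)
  also have "\<dots> \<le> Suc (card (boundary A - {?t}))" 
    by (simp add: card_insert_if assms finite_boundary)
  also have "\<dots> = card (boundary A)" using t finite_boundary[OF assms(1)] by (metis card.remove)
  finally show ?thesis using that z(1) by blast
qed

text \<open>Repeated removal of topmost points; this supplies competitors of every smaller size for
  minimal sets.\<close>

lemma exists_subset_card_boundary_le:
  assumes "finite A" "m \<le> card A"
  obtains B where "B \<subseteq> A" "card B = m" "card (boundary B) \<le> card (boundary A)"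
proof -
  have "\<exists>B\<subseteq>A. card B = m \<and> card (boundary B) \<le> card (boundary A)"
    using assms(2)
  proof (induction m rule: inc_induct)
    case base
    then show ?case by blast
  next
    case (step m)
    then obtain B where B: "B \<subseteq> A" "card B = Suc m" "card (boundary B) \<le> card (boundary A)" by blast
    then have "finite B" "B \<noteq> {}" using assms(1) finite_subset by auto
    then obtain x where "x \<in> B" "card (boundary (B - {x})) \<le> card (boundary B)"
      using boundary_remove_top by blast
    with B show ?case by (intro exI[of _ "B - {x}"]) auto
  qed
  with that show thesis by blast
qed

section \<open>Diamonds: size, boundary and diagonals\<close>

text \<open>A box in diagonal coordinates. Only coordinate pairs of equal parity occur, and the even
  side \<open>2 * p\<close> makes the size \<open>p * q\<close> for either parity of
  \<open>q\<close>.\<close>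

definition diamond :: "nat \<Rightarrow> nat \<Rightarrow> point set" where
  "diamond p q = {z. 0 \<le> usum z \<and> usum z < 2 * int p \<and> 0 \<le> vdif z \<and> vdif z < int q}"

lemma div_2_eqs:
  fixes x y :: int
  shows "(x + 1) div 2 + x div 2 = x"
    and "(x + y) div 2 + (x - y + 1) div 2 = x"
    and "(x + y) div 2 - (x - y) div 2 = y"
proof -
  show 1: "(x + 1) div 2 + x div 2 = x" for x :: int by presburger
  show 2: "(x + y) div 2 + (x - y + 1) div 2 = x" for x y :: int
  proof (cases "even (x + y)")
    case True
    then obtain c where "x + y = 2 * c" by blast
    then have "x = 2 * c - y" by simp
    then show ?thesis by simp
  next
    case False
    then obtain c where "x + y = 2 * c + 1" by (elim oddE)
    then have "x = 2 * c + 1 - y" by simp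
    then show ?thesis by simp
  qed
  show "(x + y) div 2 - (x - y) div 2 = y"
    using 2[of x y] 1[of "x - y"] by linarith
qed

text \<open>For fixed \<open>vdif\<close>, parity admits exactly one \<open>usum\<close> in each
  pair 2i, 2i + 1.\<close>

lemma diamond_bij:
  "bij_betw (\<lambda>(i, v). (i + (v + 1) div 2, i - v div 2)) ({0..<int p} \<times> {0..<int q}) (diamond p q)"
proof (rule bij_betw_byWitness[where f' = "\<lambda>z. (usum z div 2, vdif z)"])
  let ?f = "\<lambda>(i, v). (i + (v + 1) div 2, i - v div 2) :: point"
  have uv: "usum (?f (i, v)) = 2 * i + v mod 2" "vdif (?f (i, v)) = v" for i v
    using div_2_eqs(1)[of v] by (auto simp: usum_def vdif_def minus_mult_div_eq_mod[symmetric])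
  then show "\<forall>a\<in>{0..<int p} \<times> {0..<int q}. (\<lambda>z. (usum z div 2, vdif z)) (?f a) = a"
    by auto
  show "\<forall>z\<in>diamond p q. ?f (usum z div 2, vdif z) = z"
    using div_2_eqs(2,3) by (auto simp: usum_def vdif_def)
  show "?f ` ({0..<int p} \<times> {0..<int q}) \<subseteq> diamond p q"
  proof (rule image_subsetI)
    fix a assume "a \<in> {0..<int p} \<times> {0..<int q}"
    then obtain i v where a: "a = (i, v)" "0 \<le> i" "i < int p" "0 \<le> v" "v < int q" by auto
    have "0 \<le> v mod 2" "v mod 2 < 2" by simp_all
    then show "?f a \<in> diamond p q" using a(2-) uv[of i v] unfolding diamond_def mem_Collect_eq a(1) by linarith
  qed
  show "(\<lambda>z. (usum z div 2, vdif z)) ` diamond p q \<subseteq> {0..<int p} \<times> {0..<int q}"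
    unfolding diamond_def by auto
qed

lemma finite_diamond: "finite (diamond p q)"
  using bij_betw_finite[OF diamond_bij] by blast

lemma card_diamond: "card (diamond p q) = p * q"
  using bij_betw_same_card[OF diamond_bij[of p q]] by (simp add: card_cartesian_product)

lemma card_boundary_diamond_le: "card (boundary (diamond p q)) \<le> 2 * p + q + 2"
proof -
  define pt where "pt u v = ((u + v) div 2, (u - v) div 2)" for u v :: int
  \<comment> \<open>The sides u = -1 and u = 2p are counted together: the parity of v decides which
    of them it can meet, so each v contributes one point.\<close>
  let ?F1 = "(\<lambda>v. pt (if odd v then - 1 else 2 * int p) v) ` {-1..int q}"
  let ?F2 = "(\<lambda>i. pt (2 * i + 1) (- 1)) ` {0..<int p}"
  let ?F3 = "(\<lambda>i. pt (2 * i + int q mod 2) (int q)) ` {0..<int p}"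
  have "boundary (diamond p q) \<subseteq> ?F1 \<union> ?F2 \<union> ?F3"
  proof
    fix z assume z: "z \<in> boundary (diamond p q)"
    define u v where "u = usum z" and "v = vdif z"
    have zpt: "z = pt u v" by (cases z) (simp add: pt_def u_def v_def usum_def vdif_def)
    have par: "even u = even v" by (simp add: u_def v_def usum_def vdif_def)
    have rng: "-1 \<le> u" "u \<le> 2 * int p" "-1 \<le> v" "v \<le> int q"
      using z unfolding u_def v_def boundary_def diamond_def usum_def vdif_def
      by (cases z; force simp: adj_cases)+
    have out: "\<not> (0 \<le> u \<and> u < 2 * int p \<and> 0 \<le> v \<and> v < int q)"
      using z unfolding u_def v_def boundary_def diamond_def by auto
    consider "u = -1" | "u = 2 * int p" | "0 \<le> u" "u < 2 * int p" "v = -1"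
      | "0 \<le> u" "u < 2 * int p" "v = int q" using out rng by linarith
    then show "z \<in> ?F1 \<union> ?F2 \<union> ?F3"
    proof cases
      case 1
      then have "z \<in> ?F1" using par rng zpt by (intro image_eqI[of _ _ v]) auto
      then show ?thesis by blast
    next
      case 2
      then have "z \<in> ?F1" using par rng zpt by (intro image_eqI[of _ _ v]) auto
      then show ?thesis by blast
    next
      case 3
      then have "2 * (u div 2) + 1 = u" using par by simp
      then have "z \<in> ?F2" using 3 zpt by (intro image_eqI[of _ _ "u div 2"]) auto
      then show ?thesis by blast
    next
      case 4
      then have "2 * (u div 2) + int q mod 2 = u" using par by presburger
      then have "z \<in> ?F3" using 4 zpt by (intro image_eqI[of _ _ "u div 2"]) auto
      then show ?thesis by blast
    qed
  qed
  then have "card (boundary (diamond p q)) \<le> card (?F1 \<union> ?F2 \<union> ?F3)"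
    by (intro card_mono) auto
  also have "\<dots> \<le> card ?F1 + card ?F2 + card ?F3"
    by (meson add_le_mono card_Un_le le_refl le_trans)
  also have "\<dots> \<le> (q + 2) + p + p"
    using card_image_le[of "{-1..int q}"] card_image_le[of "{0..<int p}"]
    by (intro add_mono) (auto intro: le_trans[OF card_image_le])
  finally show ?thesis by simp
qed

text \<open>Every second value of \<open>vdif\<close> occurs on the diagonal. The bound is the price
  of emptying it.\<close>

lemma card_usum_line_diamond:
  assumes "0 \<le> c" "c < 2 * int p"
  shows "q \<le> card {z \<in> diamond p (2 * q). usum z = c}"
proof -
  let ?f = "\<lambda>i. (c - c div 2 + i, c div 2 - i)"
  have c: "2 * (c div 2) \<le> c" "c < 2 * (c div 2) + 2" by linarith+
  have "?f i \<in> {z \<in> diamond p (2 * q). usum z = c}" if "i \<in> {0..<int q}" for i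
    using assms that c by (simp add: diamond_def usum_def vdif_def)
  then have "card (?f ` {0..<int q}) \<le> card {z \<in> diamond p (2 * q). usum z = c}"
    by (intro card_mono) (auto simp: finite_diamond)
  moreover have "card (?f ` {0..<int q}) = q" by (subst card_image) (auto simp: inj_on_def)
  ultimately show ?thesis by simp
qed

lemma card_vdif_line_diamond:
  assumes "0 \<le> c" "c < int q"
  shows "p \<le> card {z \<in> diamond p q. vdif z = c}"
proof -
  let ?f = "\<lambda>i. (c - c div 2 + i, i - c div 2)"
  have c: "2 * (c div 2) \<le> c" "c < 2 * (c div 2) + 2" by linarith+
  have "?f i \<in> {z \<in> diamond p q. vdif z = c}" if "i \<in> {0..<int p}" for i
    using assms that c by (simp add: diamond_def usum_def vdif_def)
  then have "card (?f ` {0..<int p}) \<le> card {z \<in> diamond p q. vdif z = c}"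
    by (intro card_mono) (auto simp: finite_diamond)
  moreover have "card (?f ` {0..<int p}) = p" by (subst card_image) (auto simp: inj_on_def)
  ultimately show ?thesis by simp
qed

section \<open>Congruence classes and edges\<close>

lemma automorphism_inv: "automorphism f \<Longrightarrow> automorphism (inv f)"
  unfolding automorphism_def by (metis bij_imp_bij_inv bij_inv_eq_iff)

lemma automorphism_comp: "automorphism f \<Longrightarrow> automorphism g \<Longrightarrow> automorphism (g \<circ> f)"
  unfolding automorphism_def by (metis bij_comp comp_apply)

lemma congruent_refl: "congruent A A"
  unfolding congruent_def automorphism_def by (intro exI[of _ id]) auto

lemma congruent_sym: "congruent A B \<Longrightarrow> congruent B A"
  unfolding congruent_def
  by (metis automorphism_def automorphism_inv bij_is_inj image_inv_f_f)

lemma congruent_trans: "congruent A B \<Longrightarrow> congruent B C \<Longrightarrow> congruent A C"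
  unfolding congruent_def by (metis automorphism_comp image_comp)

lemma cong_class_eq_iff: "cong_class A = cong_class B \<longleftrightarrow> congruent A B"
  unfolding cong_class_def by (blast intro: congruent_refl congruent_sym congruent_trans)

lemma boundary_automorphism:
  assumes "automorphism f" shows "boundary (f ` A) = f ` boundary A"
proof -
  have "bij f" and a: "\<And>u v. adj (f u) (f v) = adj u v" using assms by (auto simp: automorphism_def)
  then have m: "\<And>u S. f u \<in> f ` S \<longleftrightarrow> u \<in> S" by (simp add: bij_is_inj inj_image_mem_iff)
  have "f u \<in> boundary (f ` A) \<longleftrightarrow> f u \<in> f ` boundary A" for u
    by (simp add: boundary_def m a)
  then show ?thesis using \<open>bij f\<close> by (metis bij_pointE subsetI subset_antisym)
qed

lemma card_automorphism: "automorphism f \<Longrightarrow> card (f ` A) = card A"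
  unfolding automorphism_def by (metis bij_is_inj card_image inj_on_subset subset_UNIV)

lemma congruent_card: "congruent A B \<Longrightarrow> card A = card B"
  unfolding congruent_def by (metis card_automorphism)

lemma minimal_automorphism:
  assumes "automorphism f" "minimal A" shows "minimal (f ` A)"
  using assms unfolding minimal_def
  by (simp add: boundary_automorphism card_automorphism)

text \<open>An edge may be witnessed by other representatives; an automorphism carrying
  \<open>A'\<close> to \<open>A\<close> moves the witnesses, so paths can be followed from a chosen
  set.\<close>

lemma G_edges_cong_classE:
  assumes "(cong_class A, Q) \<in> G_edges"
  obtains B where "Q = cong_class B" "minimal B" "card (sym_diff A B) = 1"
proof -
  from assms obtain A' B' C where *: "congruent A A'" "B' \<in> Q" "card (sym_diff A' B') = 1"
    "Q = cong_class C" "minimal C"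
    unfolding G_edges_def G_verts_def cong_class_def by auto
  then have CB: "congruent C B'" by (simp add: cong_class_def)
  from congruent_sym[OF *(1)] obtain f where f: "automorphism f" "f ` A' = A"
    unfolding congruent_def by blast
  have "congruent B' (f ` B')" using f(1) unfolding congruent_def by blast
  then have CfB: "congruent C (f ` B')" using CB congruent_trans by blast
  have "inj f" using f(1) by (simp add: automorphism_def bij_is_inj)
  then have "sym_diff A (f ` B') = f ` sym_diff A' B'"
    using f(2) by (metis image_Un image_set_diff)
  then have "card (sym_diff A (f ` B')) = 1" using *(3) card_automorphism[OF f(1)] by simp
  moreover have "minimal (f ` B')" using CfB minimal_automorphism[OF _ *(5)] unfolding congruent_def by metis
  moreover have "Q = cong_class (f ` B')" using *(4) CfB cong_class_eq_iff by blast
  ultimately show ?thesis using that by blast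
qed

lemma G_edges_cong_classI:
  assumes "minimal A" "minimal B" "card (sym_diff A B) = 1"
  shows "(cong_class A, cong_class B) \<in> G_edges"
  using assms unfolding G_edges_def G_verts_def cong_class_def
  by (auto intro!: bexI[of _ A] bexI[of _ B] congruent_refl)

section \<open>Rigidity of tight sets\<close>

definition tight :: "nat \<Rightarrow> point set \<Rightarrow> bool" where
  "tight k A \<longleftrightarrow> finite A \<and> 2 * k * k < card A + k \<and> card (boundary A) \<le> 4 * k + 2"

text \<open>\<open>extent_le_boundary\<close> bounds the extent from above,
  \<open>card_le_of_small_extent\<close> from below.\<close>

lemma tight_extent:
  assumes "k \<ge> 3" "tight k A" shows "extent A = 4 * k"
proof -
  have "2 * k * 3 \<le> 2 * k * k" using assms(1) by simp
  then have "A \<noteq> {}" using assms unfolding tight_def by auto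
  then have "extent A + 2 \<le> card (boundary A)"
    using assms extent_le_boundary unfolding tight_def by blast
  moreover have "\<not> extent A \<le> 4 * k - 1"
    using assms card_le_of_small_extent[of A k] unfolding tight_def by auto
  moreover have "card (boundary A) \<le> 4 * k + 2" using assms unfolding tight_def by blast
  ultimately show ?thesis by linarith
qed

text \<open>A set of equal size with smaller boundary would be tight too, so its extent
  \<open>4 * k\<close> would force at least 4k + 2 boundary points.\<close>

lemma tight_minimal:
  assumes "k \<ge> 3" "tight k A" shows "minimal A"
  unfolding minimal_def
proof (intro conjI allI impI)
  show "finite A" using assms by (simp add: tight_def)
  have "2 * k * 3 \<le> 2 * k * k" using assms(1) by simp
  then show ne: "A \<noteq> {}" using assms unfolding tight_def by auto
  fix C :: "point set" assume C: "finite C \<and> card C = card A"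
  show "card (boundary A) \<le> card (boundary C)"
  proof (rule ccontr)
    assume "\<not> ?thesis"
    then have "card (boundary C) \<le> 4 * k + 1" using assms by (simp add: tight_def)
    moreover from this have "tight k C" using C assms by (simp add: tight_def)
    then have "extent C = 4 * k" using tight_extent assms by blast
    moreover have "C \<noteq> {}" using C ne \<open>finite A\<close> by auto
    ultimately show False using extent_le_boundary[of C] C by simp
  qed
qed

text \<open>Both projection counts are monotone and their sums agree, so neither can grow.\<close>

lemma tight_subset_projections:
  assumes "k \<ge> 3" "tight k A" "tight k B" "A \<subseteq> B"
  shows "usum ` A = usum ` B" "vdif ` A = vdif ` B"
proof -
  have fin: "finite B" using assms by (simp add: tight_def)
  have "card (usum ` A) \<le> card (usum ` B)" "card (vdif ` A) \<le> card (vdif ` B)"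
    using assms fin by (auto intro!: card_mono)
  moreover have "extent A = extent B" using tight_extent assms by metis
  ultimately have "card (usum ` A) = card (usum ` B)" "card (vdif ` A) = card (vdif ` B)"
    unfolding extent_def by auto
  then show "usum ` A = usum ` B" "vdif ` A = vdif ` B"
    using assms fin by (simp_all add: card_subset_eq image_mono)
qed

lemma card_sym_diff_1E:
  assumes "card (sym_diff A B) = 1"
  obtains x where "x \<notin> A" "B = insert x A" | x where "x \<notin> B" "A = insert x B"
proof -
  from assms obtain x where "sym_diff A B = {x}" using card_1_singletonE by blast
  then have x: "(y \<in> A) = (y \<in> B) \<longleftrightarrow> y \<noteq> x" for y
    by (metis Diff_iff Un_iff singleton_iff)
  show thesis
  proof (cases "x \<in> A")
    case True
    then have "x \<notin> B" "A = insert x B" using x by (metis, metis (full_types) insert_iff set_eqI)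
    then show thesis by (rule that(2))
  next
    case False
    then have "B = insert x A" using x by (intro set_eqI) (metis insert_iff)
    with False show thesis by (rule that(1))
  qed
qed

section \<open>The component of an unbalanced diamond\<close>

text \<open>The choice of \<open>k\<close> turns 2(k + e)(k - e) into 2k^2 - k + j, so
  \<open>j\<close> is the surplus over the size threshold.\<close>

locale unbalanced_diamond =
  fixes k e j :: nat
  assumes k_eq: "k = 2 * e * e + j" and e_pos: "e \<ge> 1" and j_pos: "j \<ge> 1"
begin

definition R :: "point set" where "R = diamond (k + e) (2 * (k - e))"

lemma k_ge_3: "k \<ge> 3"
  and e_less: "e < k" and j_less: "j < k - e"
proof -
  have "e * 1 \<le> e * e" using e_pos by (intro mult_le_mono) auto
  moreover have "k = 2 * (e * e) + j" using k_eq by simp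
  ultimately show "k \<ge> 3" "e < k" "j < k - e" using e_pos j_pos by linarith+
qed

lemma finite_R: "finite R"
  by (simp add: R_def finite_diamond)

lemma card_R: "card R + k = 2 * k * k + j"
proof -
  have "int (card R) = 2 * (int k + int e) * (int k - int e)"
  proof -
    have "int (k - e) = int k - int e" using e_less by (simp add: of_nat_diff)
    then show ?thesis by (simp only: R_def card_diamond of_nat_mult of_nat_add of_nat_numeral)
  qed
  also have "\<dots> = 2 * int k * int k - 2 * int e * int e" by (simp add: algebra_simps)
  finally have "int (card R + k) = int (2 * k * k + j)" using k_eq by simp
  then show ?thesis by (simp only: of_nat_eq_iff)
qed

lemma tight_R: "tight k R"
proof -
  have "card (boundary R) \<le> 4 * k + 2"
    using card_boundary_diamond_le[of "k + e" "2 * (k - e)"] e_less by (simp add: R_def)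
  then show ?thesis using finite_R card_R j_pos by (simp add: tight_def)
qed

text \<open>The invariant carried along edges; as \<open>R\<close> is a full box, it confines
  \<open>A\<close> to \<open>R\<close>.\<close>

definition spans_R :: "point set \<Rightarrow> bool" where
  "spans_R A \<longleftrightarrow> tight k A \<and> usum ` A = usum ` R \<and> vdif ` A = vdif ` R"

lemma spans_R_subset:
  assumes "spans_R A" shows "A \<subseteq> R"
proof
  fix z assume "z \<in> A"
  then have "usum z \<in> usum ` R" "vdif z \<in> vdif ` R" using assms unfolding spans_R_def by blast+
  then show "z \<in> R" unfolding R_def diamond_def by auto
qed

text \<open>A missing projection value costs a whole diagonal of \<open>R\<close>, which has at
  least \<open>k - e\<close> points.\<close>

lemma card_of_smaller_extent:
  assumes "B \<subseteq> R" "usum ` B \<noteq> usum ` R \<or> vdif ` B \<noteq> vdif ` R"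
  shows "card B + (k - e) \<le> card R"
proof -
  have *: "card B + (k - e) \<le> card R"
    if "L \<subseteq> R" "k - e \<le> card L" "B \<inter> L = {}" for L
  proof -
    have "card B + card L = card (B \<union> L)"
      using that assms finite_R by (metis card_Un_disjoint finite_subset)
    also have "\<dots> \<le> card R" using that assms finite_R by (intro card_mono) auto
    finally show ?thesis using that by simp
  qed
  from assms consider c where "c \<in> usum ` R" "c \<notin> usum ` B" | c where "c \<in> vdif ` R" "c \<notin> vdif ` B"
    by blast
  then show ?thesis
  proof cases
    case 1
    have "0 \<le> c" "c < 2 * int (k + e)" using 1(1) by (auto simp: R_def diamond_def)
    then have "k - e \<le> card {z \<in> R. usum z = c}"
      unfolding R_def by (rule card_usum_line_diamond)
    moreover have "B \<inter> {z \<in> R. usum z = c} = {}" using 1(2) by blast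
    ultimately show ?thesis by (intro *[of "{z \<in> R. usum z = c}"]) auto
  next
    case 2
    have "0 \<le> c" "c < int (2 * (k - e))" using 2(1) by (auto simp: R_def diamond_def)
    then have "k + e \<le> card {z \<in> R. vdif z = c}"
      unfolding R_def by (rule card_vdif_line_diamond)
    moreover have "B \<inter> {z \<in> R. vdif z = c} = {}" using 2(2) by blast
    ultimately show ?thesis by (intro *[of "{z \<in> R. vdif z = c}"]) auto
  qed
qed

lemma spans_R_step:
  assumes A: "spans_R A" and B: "minimal B" and AB: "card (sym_diff A B) = 1"
  shows "spans_R B"
proof -
  have tA: "tight k A" and AR: "A \<subseteq> R" using A spans_R_subset by (auto simp: spans_R_def)
  have fin: "finite A" "finite B" using tA B by (auto simp: tight_def minimal_def)
  have cA: "card A \<le> card R" using AR finite_R by (simp add: card_mono)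
  have min: "card (boundary B) \<le> card (boundary C)" if "finite C" "card C = card B" for C
    using B that unfolding minimal_def by blast
  \<comment> \<open>The competitor is a subset of the balanced diamond, which has 2k^2
    points.\<close>
  have bB: "card (boundary B) \<le> 4 * k + 2" if "card B \<le> 2 * k * k"
  proof -
    have "card B \<le> card (diamond k (2 * k))" using that by (simp add: card_diamond)
    then obtain C where C: "C \<subseteq> diamond k (2 * k)" "card C = card B"
      "card (boundary C) \<le> card (boundary (diamond k (2 * k)))"
      using exists_subset_card_boundary_le finite_diamond by metis
    then have "finite C" using finite_diamond finite_subset by blast
    from min[OF this C(2)] C(3) card_boundary_diamond_le[of k "2 * k"] show ?thesis by simp
  qed
  show ?thesis
    using AB
  proof (cases rule: card_sym_diff_1E)
    case (1 x)
    then have c: "card B = Suc (card A)" using fin by simp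
    have "j < k" using j_less by simp
    then have "card B \<le> 2 * k * k" using c cA card_R by simp
    \<comment> \<open>\<open>B\<close> still has at most 2k^2 points because j < k; equal
      projections then keep even the added point inside \<open>R\<close>.\<close>
    then have "tight k B" using bB tA c fin by (simp add: tight_def)
    then show ?thesis using tight_subset_projections[OF k_ge_3 tA] 1 A
      unfolding spans_R_def by (metis subset_insertI)
  next
    case (2 x)
    then have c: "card A = Suc (card B)" using fin by simp
    have "j < k" using j_less by simp
    then have b: "card (boundary B) \<le> 4 * k + 2" using bB c cA card_R by simp
    show ?thesis
    proof (cases "2 * k * k < card B + k")
      case True
      then have "tight k B" using b fin by (simp add: tight_def)
      then show ?thesis using tight_subset_projections[OF k_ge_3 _ tA] 2 A
        unfolding spans_R_def by (metis subset_insertI)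
    next
      case False
      then have cB: "card B + k = 2 * k * k" using c tA by (simp add: tight_def)
      \<comment> \<open>At exactly 2k^2 - k points this diamond has one boundary point fewer, so
        \<open>B\<close> must lose a diagonal; but it has only \<open>j\<close> points fewer than
        \<open>R\<close>.\<close>
      have "card (diamond k (2 * k - 1)) + k = 2 * k * k"
        using k_ge_3 by (simp add: card_diamond diff_mult_distrib2)
      then have "card (boundary B) \<le> card (boundary (diamond k (2 * k - 1)))"
        using cB min finite_diamond by simp
      also have "\<dots> \<le> 4 * k + 1" using card_boundary_diamond_le[of k "2 * k - 1"] k_ge_3 by simp
      finally have bd: "card (boundary B) \<le> 4 * k + 1" .
      have "B \<noteq> {}" using B by (simp add: minimal_def)
      then have "extent B < 4 * k" using extent_le_boundary[OF fin(2)] bd by simp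
      then have "extent B \<noteq> extent R" using tight_extent[OF k_ge_3 tight_R] by simp
      then have "usum ` B \<noteq> usum ` R \<or> vdif ` B \<noteq> vdif ` R" unfolding extent_def by auto
      moreover have "B \<subseteq> R" using 2(2) AR by simp
      ultimately have "card B + (k - e) \<le> card R" by (intro card_of_smaller_extent)
      then show ?thesis using cB card_R j_less by simp
    qed
  qed
qed

definition comp_R :: "point set set set" where "comp_R = G_edges\<^sup>* `` {cong_class R}"

lemma comp_R_in_G_components: "comp_R \<in> G_components"
  unfolding comp_R_def G_components_def G_verts_def
  using tight_minimal[OF k_ge_3 tight_R] by blast

lemma finite_comp_R: "finite comp_R"
proof -
  have "\<exists>A. Q = cong_class A \<and> spans_R A" if "(cong_class R, Q) \<in> G_edges\<^sup>*" for Q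
    using that
  proof (induction rule: rtrancl_induct)
    case base
    then show ?case using tight_R spans_R_def by blast
  next
    case (step P Q)
    then show ?case using G_edges_cong_classE spans_R_step by metis
  qed
  then have "comp_R \<subseteq> cong_class ` Pow R" unfolding comp_R_def using spans_R_subset by blast
  then show ?thesis by (rule finite_subset) (simp add: finite_R)
qed

text \<open>Topmost points are removed one by one, each new set going to the head of the increasing
  list. The bound \<open>i < j\<close> keeps all sizes above the threshold.\<close>

lemma nested_seq_comp_R:
  assumes "i < j"
  shows "\<exists>C As. nested_seq_in comp_R (C # As) \<and> length As = i \<and> tight k C \<and> card C + i = card R"
  using assms
proof (induction i)
  case 0
  have "nested_seq_in comp_R [R]"
    unfolding nested_seq_in_def comp_R_def using tight_minimal[OF k_ge_3 tight_R] by simp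
  then show ?case using tight_R by (intro exI[of _ R] exI[of _ "[]"]) simp
next
  case (Suc i)
  then obtain C As where C: "nested_seq_in comp_R (C # As)" "length As = i" "tight k C"
    "card C + i = card R" by auto
  have mC: "minimal C" using C(3) tight_minimal k_ge_3 by blast
  then have fC: "finite C" "C \<noteq> {}" by (auto simp: minimal_def)
  then obtain x where x: "x \<in> C" "card (boundary (C - {x})) \<le> card (boundary C)"
    using boundary_remove_top by blast
  let ?D = "C - {x}"
  have cD: "Suc (card ?D) = card C" using fC x by (metis card.remove)
  then have tD: "tight k ?D" using C x fC Suc.prems card_R by (simp add: tight_def)
  then have mD: "minimal ?D" using tight_minimal k_ge_3 by blast
  have "sym_diff C ?D = {x}" using x by blast
  then have "(cong_class C, cong_class ?D) \<in> G_edges" using mC mD by (intro G_edges_cong_classI) auto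
  moreover have "(cong_class R, cong_class C) \<in> G_edges\<^sup>*"
    using C(1) unfolding nested_seq_in_def comp_R_def by simp
  ultimately have "cong_class ?D \<in> comp_R" unfolding comp_R_def by simp
  moreover have "?D \<subset> C" using x by blast
  ultimately have "nested_seq_in comp_R (?D # C # As)"
    using C(1) mD unfolding nested_seq_in_def by auto
  then show ?case using C cD tD by (intro exI[of _ ?D] exI[of _ "C # As"]) simp
qed

lemma height_comp_R: "enat j \<le> height comp_R"
proof -
  obtain C As where "nested_seq_in comp_R (C # As)" "length (C # As) = j"
    using nested_seq_comp_R[of "j - 1"] j_pos by force
  then show ?thesis unfolding height_def by (intro Sup_upper) blast
qed

text \<open>For \<open>j = 1\<close> the diamond has the least size of a tight set, whereas a
  neighbour would yield a tight proper subset.\<close>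

lemma G_isolated_R:
  assumes "j = 1" shows "G_isolated (cong_class R)"
  unfolding G_isolated_def
proof
  show "cong_class R \<in> G_verts"
    unfolding G_verts_def using tight_minimal[OF k_ge_3 tight_R] by blast
  show "\<not> (\<exists>Q. (cong_class R, Q) \<in> G_edges)"
  proof
    assume "\<exists>Q. (cong_class R, Q) \<in> G_edges"
    then obtain B where B: "minimal B" "card (sym_diff R B) = 1" using G_edges_cong_classE by metis
    then have a: "spans_R B" using spans_R_step tight_R spans_R_def by blast
    then have "B \<subseteq> R" by (rule spans_R_subset)
    moreover have "B \<noteq> R" using B by auto
    ultimately have "card B < card R" using finite_R by (simp add: psubset_card_mono psubset_eq)
    then show False using a card_R assms unfolding spans_R_def tight_def by simp
  qed
qed

end

theorem theorem8p11:
  "(\<forall>n::nat. \<exists>K\<in>G_components. finite K \<and> enat n \<le> height K) \<and>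
   infinite {P. G_isolated P}"
proof
  show "\<forall>n::nat. \<exists>K\<in>G_components. finite K \<and> enat n \<le> height K"
  proof
    fix n
    \<comment> \<open>Here \<open>e\<close> is 1 and \<open>j\<close> is \<open>Suc n\<close>, which
      is positive also for n = 0.\<close>
    interpret unbalanced_diamond "2 + Suc n" 1 "Suc n" by unfold_locales auto
    have "enat n \<le> enat (Suc n)" by simp
    then have "enat n \<le> height comp_R" using height_comp_R by (rule order_trans)
    then show "\<exists>K\<in>G_components. finite K \<and> enat n \<le> height K"
      using comp_R_in_G_components finite_comp_R by blast
  qed
  define k where "k e = 2 * Suc e * Suc e + 1" for e
  define D where "D e = diamond (k e + Suc e) (2 * (k e - Suc e))" for e
  have L: "unbalanced_diamond (k e) (Suc e) 1" for e by unfold_locales (auto simp: k_def)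
  have RD: "unbalanced_diamond.R (k e) (Suc e) = D e" for e
    using unbalanced_diamond.R_def[OF L] D_def by simp
  have iso: "G_isolated (cong_class (D e))" for e
    using unbalanced_diamond.G_isolated_R[OF L] RD by metis
  have card: "card (D e) + k e = 2 * k e * k e + 1" for e
    using unbalanced_diamond.card_R[OF L] RD by metis
  \<comment> \<open>Congruent sets have equal size, so growing sizes make the classes
    distinct.\<close>
  have "strict_mono (\<lambda>e. card (D e))"
  unfolding strict_mono_Suc_iff
  proof
    fix e
    define a b where "a = k e" and "b = k (Suc e)"
    have ab: "a < b" "a \<ge> 1" by (simp_all add: a_def b_def k_def)
    then have "2 * (a + 1) * b \<le> 2 * b * b" "2 * a * (a + 1) \<le> 2 * a * b"
      by (intro mult_le_mono; simp)+
    then have "2 * a * a + b < 2 * b * b + a" using ab by (simp add: algebra_simps)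
    then show "card (D e) < card (D (Suc e))"
      using card[of e] card[of "Suc e"] unfolding a_def b_def by simp
  qed
  then have "inj (\<lambda>e. cong_class (D e))"
    unfolding inj_def cong_class_eq_iff by (metis congruent_card strict_mono_eq)
  then have "infinite (range (\<lambda>e. cong_class (D e)))" by (rule range_inj_infinite)
  then show "infinite {P. G_isolated P}" using iso by (meson finite_subset image_subsetI mem_Collect_eq)
qed

end
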